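(* Let $G$ be a locally compact group, let $\mathfrak{A}$ be the associated complete Boolean algebra of Haar measurable sets modulo null sets, and let $a\in\mathfrak{A}$. Denote by $\mathcal{N}$ the family of open neighborhoods of the unit in $G$. Then the following are equivalent: 1. $a=[U]$ for some open subset $U\subseteq G$; 2. the left action $l\colon G\to\mathrm{Aut}(\mathfrak{A})$ is lower semicontinuous at $a$, that is, $a=\bigvee_{V\in\mathcal{N}}\bigwedge_{s\in V}l_s(a)$; 3. the right action $r\colon G\to\mathrm{Aut}(\mathfrak{A})$ is lower semicontinuous at $a$, that is, $a=\bigvee_{V\in\mathcal{N}}\bigwedge_{s\in V}r_s(a)$. Analogously, $a=[M]$ for some closed subset $M\subseteq G$ if and only if $l$ is upper semicontinuous at $a$, that is, $a=\bigwedge_{V\in\mathcal{N}}\bigvee_{s\in V}l_s(a)$, and equivalently if and only if $r$ is upper semicontinuous at $a$, that is, $a=\bigwedge_{V\in\mathcal{N}}\bigvee_{s\in V}r_s(a)$.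
   Context: $\Sigma$ is the $\sigma$-algebra of Haar measurable subsets of $G$ (containing all Borel sets) and $\mu\colon\Sigma\to[0,\infty]$ a left Haar measure, taken to be complete and strictly localizable (there is a partition of $G$ into measurable sets $B_j$ of finite measure such that $Z\subseteq G$ is measurable iff every $Z\cap B_j$ is, and then $\mu(Z)=\sum_j\mu(Z\cap B_j)$). $\mathfrak{A}$ is the quotient of $\Sigma$ by the ideal of null sets; it is a complete Boolean algebra. $[M]$ denotes the class of $M\in\Sigma$. For $s\in G$, $l_s,r_s\in\mathrm{Aut}(\mathfrak{A})$ are the Boolean automorphisms with $l_s([M])=[sM]$ and $r_s([M])=[Ms]$. *)

theory Defs
  imports "HOL-Analysis.Analysis" "HOL-Algebra.Complete_Lattice"
begin

text \<open>
  Groups are written additively, as in the class \<open>topological_group_add\<close>, which does not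
  assume commutativity: \<open>s + x\<close> is the product \<open>sx\<close>, \<open>x + s\<close> is \<open>xs\<close>, and \<open>0\<close> is the unit.
  A locally compact group is by convention Hausdorff.
\<close>

definition strictly_localizable :: "'a measure \<Rightarrow> bool" where
  "strictly_localizable M \<longleftrightarrow>
     (\<exists>\<B>. partition_on (space M) \<B> \<and>
          (\<forall>B\<in>\<B>. B \<in> sets M \<and> emeasure M B < \<infinity>) \<and>
          (\<forall>Z. Z \<subseteq> space M \<longrightarrow> (Z \<in> sets M \<longleftrightarrow> (\<forall>B\<in>\<B>. Z \<inter> B \<in> sets M))) \<and>
          (\<forall>Z\<in>sets M. emeasure M Z = (\<Sum>\<^sub>\<infinity>B\<in>\<B>. emeasure M (Z \<inter> B))))"

text \<open>
  A Haar measure is understood as a nonzero left-invariant Radon measure on the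
  \<open>\<sigma>\<close>-algebra of all Haar measurable sets, not only on the Borel sets.  For a complete,
  strictly localizable measure, regularity has to be inner regularity of all measurable
  sets by compact sets: outer regularity of Borel sets by open sets fails in this setting,
  e.g. for \<open>{0} \<times> D\<close> in \<open>\<real> \<times> D\<close> with \<open>D\<close> an uncountable discrete group.
  Inner regularity also ensures that \<open>sets M\<close> is not larger than the \<open>\<sigma>\<close>-algebra
  of Haar measurable sets.
\<close>

definition left_haar_measure :: "'a::{topological_group_add, t2_space} measure \<Rightarrow> bool" where
  "left_haar_measure M \<longleftrightarrow>
     space M = UNIV \<and> sets borel \<subseteq> sets M \<and>
     complete_measure M \<and> strictly_localizable M \<and>
     emeasure M UNIV \<noteq> 0 \<and>
     (\<forall>K. compact K \<longrightarrow> emeasure M K < \<infinity>) \<and>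
     (\<forall>A\<in>sets M. emeasure M A = (SUP K\<in>{K. compact K \<and> K \<subseteq> A}. emeasure M K)) \<and>
     (\<forall>s. \<forall>A\<in>sets M. (\<lambda>x. s + x) ` A \<in> sets M \<and>
                      emeasure M ((\<lambda>x. s + x) ` A) = emeasure M A)"


definition null_rel :: "'a measure \<Rightarrow> ('a set \<times> 'a set) set" where
  "null_rel M = {(A, B). A \<in> sets M \<and> B \<in> sets M \<and> sym_diff A B \<in> null_sets M}"

definition mclass :: "'a measure \<Rightarrow> 'a set \<Rightarrow> 'a set set" where
  "mclass M A = null_rel M `` {A}"

text \<open>
  The quotient of \<open>sets M\<close> by the null sets, as an ordered structure; its suprema and infima
  are the lattice operations \<open>\<Squnion>\<close> and \<open>\<Sqinter>\<close> of this order.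
\<close>

definition measure_algebra :: "'a measure \<Rightarrow> 'a set set gorder" where
  "measure_algebra M =
     \<lparr>carrier = sets M // null_rel M, eq = (=),
      le = (\<lambda>a b. \<exists>A\<in>a. \<exists>B\<in>b. A - B \<in> null_sets M)\<rparr>"

text \<open>
  Both actions are given on representatives and lifted to classes by the usual union over
  a class, so that \<open>left_act M s [A] = [sA]\<close> and \<open>right_act M s [A] = [As]\<close> for a Haar
  measure \<open>M\<close>.
\<close>

definition left_act ::
    "'a::topological_group_add measure \<Rightarrow> 'a \<Rightarrow> 'a set set \<Rightarrow> 'a set set" where
  "left_act M s a = (\<Union>A\<in>a. mclass M ((\<lambda>x. s + x) ` A))"

definition right_act ::
    "'a::topological_group_add measure \<Rightarrow> 'a \<Rightarrow> 'a set set \<Rightarrow> 'a set set" where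
  "right_act M s a = (\<Union>A\<in>a. mclass M ((\<lambda>x. x + s) ` A))"

definition unit_nhds :: "'a::topological_group_add set set" where
  "unit_nhds = {V. open V \<and> 0 \<in> V}"

definition lower_semicontinuous_at ::
    "'b gorder \<Rightarrow> ('a::topological_group_add \<Rightarrow> 'b \<Rightarrow> 'b) \<Rightarrow> 'b \<Rightarrow> bool" where
  "lower_semicontinuous_at L act a \<longleftrightarrow>
     a = \<Squnion>\<^bsub>L\<^esub> ((\<lambda>V. \<Sqinter>\<^bsub>L\<^esub> ((\<lambda>s. act s a) ` V)) ` unit_nhds)"

definition upper_semicontinuous_at ::
    "'b gorder \<Rightarrow> ('a::topological_group_add \<Rightarrow> 'b \<Rightarrow> 'b) \<Rightarrow> 'b \<Rightarrow> bool" where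
  "upper_semicontinuous_at L act a \<longleftrightarrow>
     a = \<Sqinter>\<^bsub>L\<^esub> ((\<lambda>V. \<Squnion>\<^bsub>L\<^esub> ((\<lambda>s. act s a) ` V)) ` unit_nhds)"


lemma null_set_subset3:
  assumes "A \<in> sets M" "A \<subseteq> P \<union> Q" "P \<in> null_sets M" "Q \<in> null_sets M"
  shows "A \<in> null_sets M"
  by (rule null_sets_subset[OF null_sets.Un[OF assms(3,4)] assms(1,2)])

lemma equiv_null_rel: "equiv (sets M) (null_rel M)"
proof (rule equivI)
  show "null_rel M \<subseteq> sets M \<times> sets M" by (auto simp: null_rel_def)
  show "refl_on (sets M) (null_rel M)" by (auto simp: null_rel_def refl_on_def)
  show "sym (null_rel M)" by (auto simp: null_rel_def sym_def Un_commute)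
  show "trans (null_rel M)"
  proof (rule transI)
    fix A B C assume h: "(A, B) \<in> null_rel M" "(B, C) \<in> null_rel M"
    have "sym_diff A C \<in> null_sets M"
      by (rule null_set_subset3[where P = "sym_diff A B" and Q = "sym_diff B C"])
        (use h in \<open>simp_all add: null_rel_def sets.Un sets.Diff\<close>, blast)
    then show "(A, C) \<in> null_rel M" using h by (auto simp: null_rel_def)
  qed
qed

lemma mclass_eq_iff:
  assumes "A \<in> sets M" "B \<in> sets M"
  shows "mclass M A = mclass M B \<longleftrightarrow> sym_diff A B \<in> null_sets M"
  unfolding mclass_def using eq_equiv_class_iff[OF equiv_null_rel assms] assms
  by (auto simp: null_rel_def)

lemma le_mclass_iff:
  assumes "A \<in> sets M" "B \<in> sets M"
  shows "mclass M A \<sqsubseteq>\<^bsub>measure_algebra M\<^esub> mclass M B \<longleftrightarrow> A - B \<in> null_sets M"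
proof
  assume "mclass M A \<sqsubseteq>\<^bsub>measure_algebra M\<^esub> mclass M B"
  then obtain A' B' where h: "sym_diff A A' \<in> null_sets M" "sym_diff B B' \<in> null_sets M"
      "A' - B' \<in> null_sets M"
    by (auto simp: measure_algebra_def mclass_def null_rel_def)
  show "A - B \<in> null_sets M"
    by (rule null_set_subset3[where P = "sym_diff A A' \<union> sym_diff B B'" and Q = "A' - B'"])
      (use assms h in \<open>blast intro: sets.Diff null_sets.Un\<close>)+
next
  assume "A - B \<in> null_sets M"
  moreover have "A \<in> mclass M A" "B \<in> mclass M B"
    using assms by (simp_all add: mclass_def null_rel_def)
  ultimately show "mclass M A \<sqsubseteq>\<^bsub>measure_algebra M\<^esub> mclass M B"
    by (auto simp: measure_algebra_def)
qed

lemma carrier_measure_algebra: "carrier (measure_algebra M) = mclass M ` sets M"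
  by (auto simp: measure_algebra_def mclass_def quotient_def)

lemma partial_order_measure_algebra: "partial_order (measure_algebra M)"
proof -
  have [simp]: "eq (measure_algebra M) = (=)" by (simp add: measure_algebra_def)
  show ?thesis
  proof
    fix x y z
    assume "x \<in> carrier (measure_algebra M)" "y \<in> carrier (measure_algebra M)"
      "z \<in> carrier (measure_algebra M)"
      and le: "x \<sqsubseteq>\<^bsub>measure_algebra M\<^esub> y" "y \<sqsubseteq>\<^bsub>measure_algebra M\<^esub> z"
    then obtain A B C where ABC: "A \<in> sets M" "B \<in> sets M" "C \<in> sets M"
        "x = mclass M A" "y = mclass M B" "z = mclass M C"
      by (auto simp: carrier_measure_algebra)
    with le have "A - B \<in> null_sets M" "B - C \<in> null_sets M"
      by (simp_all add: le_mclass_iff)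
    then have "A - C \<in> null_sets M"
      by (rule null_set_subset3[where P = "A - B" and Q = "B - C", rotated 2])
        (use ABC in \<open>blast intro: sets.Diff\<close>)+
    with ABC show "x \<sqsubseteq>\<^bsub>measure_algebra M\<^esub> z" by (simp add: le_mclass_iff)
  next
    fix x y
    assume "x \<sqsubseteq>\<^bsub>measure_algebra M\<^esub> y" "y \<sqsubseteq>\<^bsub>measure_algebra M\<^esub> x"
      "x \<in> carrier (measure_algebra M)" "y \<in> carrier (measure_algebra M)"
    then show "x .=\<^bsub>measure_algebra M\<^esub> y"
      by (clarsimp simp: carrier_measure_algebra le_mclass_iff) (simp add: mclass_eq_iff null_sets.Un)
  qed (simp_all, auto simp: carrier_measure_algebra le_mclass_iff)
qed

lemma left_act_mclass:
  assumes "left_haar_measure M" "A \<in> sets M"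
  shows "left_act M s (mclass M A) = mclass M ((\<lambda>x. s + x) ` A)"
proof -
  have inv: "(\<lambda>x. s + x) ` B \<in> sets M \<and> emeasure M ((\<lambda>x. s + x) ` B) = emeasure M B"
    if "B \<in> sets M" for B
    using assms(1) that unfolding left_haar_measure_def by blast
  have "mclass M ((\<lambda>x. s + x) ` B) = mclass M ((\<lambda>x. s + x) ` A)" if "B \<in> mclass M A" for B
  proof -
    have B: "B \<in> sets M" "sym_diff B A \<in> null_sets M"
      using that by (auto simp: mclass_def null_rel_def Un_commute)
    have "sym_diff ((\<lambda>x. s + x) ` B) ((\<lambda>x. s + x) ` A) = (\<lambda>x. s + x) ` sym_diff B A"
      by (auto simp: image_iff)
    also have "\<dots> \<in> null_sets M"
      using inv[OF null_setsD2[OF B(2)]] null_setsD1[OF B(2)] by (intro null_setsI) simp_all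
    finally show ?thesis using inv B(1) assms(2) by (simp add: mclass_eq_iff)
  qed
  moreover have "A \<in> mclass M A" using assms(2) by (auto simp: mclass_def null_rel_def)
  ultimately show ?thesis unfolding left_act_def by blast
qed

end

theory Submission
  imports Defs
begin

text \<open>
  If \<open>K \<subseteq> U\<close> with \<open>K\<close> compact and \<open>U\<close> open, then \<open>K \<subseteq> s + U\<close> for all \<open>s\<close> near \<open>0\<close>; by inner
  regularity, \<open>[U]\<close> is a point of lower semicontinuity.  Conversely, given \<open>A\<close>, let \<open>U\<close> be the
  union of all open \<open>N\<close> with \<open>N - A\<close> null; then \<open>U - A\<close> is null.  Let \<open>V\<close> be a symmetric
  neighbourhood of \<open>0\<close> and suppose that \<open>C - (s + A)\<close> is null for all \<open>s \<in> V\<close>, but \<open>C - U\<close> is not null.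
  Choose a point \<open>x\<close> of a compact subset of \<open>C - U\<close> at which this subset is locally non-null, and a
  neighbourhood \<open>N\<close> of \<open>x\<close> so small that \<open>N - N \<subseteq> V\<close>.  As \<open>x \<notin> U\<close>, the set \<open>N - A\<close> contains a
  non-null compact \<open>F\<close>, and \<open>C \<inter> N\<close> contains a non-null compact \<open>L\<close>.  By a Fubini argument some
  translate \<open>s + L\<close> meets \<open>F\<close> in a non-null set, which forces \<open>s \<in> V\<close> and contradicts that
  \<open>(s + C) - A\<close> is null.  So \<open>C - U\<close> is always null, and lower semicontinuity gives \<open>[A] \<le> [U]\<close>.

  The same Fubini argument shows that inversion preserves null sets.  Hence right translations act
  on the measure algebra, and the proof applies to them as well.  Closed sets are treated by
  complementation.
\<close>

section \<open>Completeness of the measure algebra\<close>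

text \<open>Take a countable subfamily whose union has maximal measure inside \<open>B\<close>.\<close>

lemma countable_subfamily_ess_cover:
  assumes B: "B \<in> sets M" "emeasure M B < \<infinity>" and F: "F \<subseteq> sets M"
  obtains C where "C \<subseteq> F" "countable C" "\<And>A. A \<in> F \<Longrightarrow> A \<inter> B - \<Union>C \<in> null_sets M"
proof -
  define I where "I = {C. C \<subseteq> F \<and> countable C}"
  define g where "g C = emeasure M (B \<inter> \<Union>C)" for C
  have Un_sets: "\<Union>C \<in> sets M" if "C \<in> I" for C
    using that F by (auto simp: I_def intro!: sets.countable_Union)
  have "{} \<in> I" by (simp add: I_def)
  then have "I \<noteq> {}" by blast
  from ennreal_SUP_countable_SUP[OF this, of g]
  obtain f :: "nat \<Rightarrow> ennreal" where f: "range f \<subseteq> g ` I" "Sup (g ` I) = Sup (range f)"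
    by blast
  then have "\<forall>n. \<exists>C\<in>I. f n = g C" by blast
  then obtain c where c: "\<And>n. c n \<in> I" "\<And>n. f n = g (c n)" by metis
  define D where "D = (\<Union>n. c n)"
  have D: "D \<in> I" using c(1) by (auto simp: D_def I_def)
  show thesis
  proof
    show "D \<subseteq> F" "countable D" using D by (auto simp: I_def)
    fix A assume A: "A \<in> F"
    have AD: "insert A D \<in> I" using A D by (auto simp: I_def)
    \<comment> \<open>\<open>g\<close> attains its supremum over \<open>I\<close> at
      \<open>D\<close>, so adjoining \<open>A\<close> to \<open>D\<close> cannot raise it.\<close>
    have "g (insert A D) \<le> Sup (range f)" using AD by (simp flip: f(2) add: SUP_upper)
    also have "\<dots> \<le> g D"
    proof (rule SUP_least)
      fix n
      have "B \<inter> \<Union>(c n) \<subseteq> B \<inter> \<Union>D" by (auto simp: D_def)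
      then show "f n \<le> g D"
        using Un_sets[OF D] B by (simp add: c(2) g_def emeasure_mono)
    qed
    finally have le: "g (insert A D) \<le> g D" .
    have sub: "B \<inter> \<Union>D \<subseteq> B \<inter> \<Union>(insert A D)" by auto
    have fin: "emeasure M (B \<inter> \<Union>D) \<noteq> \<infinity>"
      using B emeasure_mono[of "B \<inter> \<Union>D" B M] by (auto simp: top_unique)
    have "emeasure M (B \<inter> \<Union>(insert A D) - B \<inter> \<Union>D) = g (insert A D) - g D"
      unfolding g_def using sub fin Un_sets[OF D] Un_sets[OF AD] B
      by (intro emeasure_Diff) auto
    also have "\<dots> = 0" using le fin by (auto simp: g_def less_top intro!: diff_eq_0_ennreal elim: le_less_trans)
    finally have "B \<inter> \<Union>(insert A D) - B \<inter> \<Union>D \<in> null_sets M"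
      using Un_sets[OF D] Un_sets[OF AD] B by (intro null_setsI) auto
    moreover have "B \<inter> \<Union>(insert A D) - B \<inter> \<Union>D = A \<inter> B - \<Union>D" by auto
    ultimately show "A \<inter> B - \<Union>D \<in> null_sets M" by simp
  qed
qed

text \<open>On each block \<open>B\<close> of the partition the supremum is a countable union from
  \<open>F\<close>. The blocks are disjoint, so these unions can be glued; strict localizability
  makes the result measurable and lets nullity be tested blockwise.\<close>

lemma strictly_localizable_ess_sup_exists:
  assumes sl: "strictly_localizable M" and F: "F \<subseteq> sets M"
  obtains S where "S \<in> sets M" "\<And>A. A \<in> F \<Longrightarrow> A - S \<in> null_sets M"
    "\<And>T. T \<in> sets M \<Longrightarrow> (\<And>A. A \<in> F \<Longrightarrow> A - T \<in> null_sets M) \<Longrightarrow> S - T \<in> null_sets M"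
proof -
  from sl obtain P where *: "partition_on (space M) P \<and>
      (\<forall>B\<in>P. B \<in> sets M \<and> emeasure M B < \<infinity>) \<and>
      (\<forall>Z. Z \<subseteq> space M \<longrightarrow> (Z \<in> sets M \<longleftrightarrow> (\<forall>B\<in>P. Z \<inter> B \<in> sets M))) \<and>
      (\<forall>Z\<in>sets M. emeasure M Z = (\<Sum>\<^sub>\<infinity>B\<in>P. emeasure M (Z \<inter> B)))"
    unfolding strictly_localizable_def by (rule exE)
  have P: "partition_on (space M) P"
    and fin: "\<And>B. B \<in> P \<Longrightarrow> B \<in> sets M \<and> emeasure M B < \<infinity>"
    and meas: "\<And>Z. Z \<subseteq> space M \<Longrightarrow> Z \<in> sets M \<longleftrightarrow> (\<forall>B\<in>P. Z \<inter> B \<in> sets M)"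
    and em: "\<And>Z. Z \<in> sets M \<Longrightarrow> emeasure M Z = (\<Sum>\<^sub>\<infinity>B\<in>P. emeasure M (Z \<inter> B))"
    using * by blast+
  have nullI: "Z \<in> null_sets M" if "Z \<in> sets M" "\<And>B. B \<in> P \<Longrightarrow> Z \<inter> B \<in> null_sets M" for Z
  proof (rule null_setsI)
    show "emeasure M Z = 0"
      unfolding em[OF that(1)] by (rule infsum_0) (use that(2) in blast)
  qed fact
  have "\<forall>B\<in>P. \<exists>C\<subseteq>F. countable C \<and> (\<forall>A\<in>F. A \<inter> B - \<Union>C \<in> null_sets M)"
    using countable_subfamily_ess_cover[OF _ _ F] fin by metis
  then obtain c where c: "\<And>B. B \<in> P \<Longrightarrow> c B \<subseteq> F" "\<And>B. B \<in> P \<Longrightarrow> countable (c B)"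
    "\<And>B A. B \<in> P \<Longrightarrow> A \<in> F \<Longrightarrow> A \<inter> B - \<Union>(c B) \<in> null_sets M"
    by metis
  have cs: "\<Union>(c B) \<in> sets M" if "B \<in> P" for B
    using c(1,2)[OF that] F by (intro sets.countable_Union) blast+
  define S where "S = (\<Union>B\<in>P. B \<inter> \<Union>(c B))"
  have SB: "S \<inter> B = B \<inter> \<Union>(c B)" if "B \<in> P" for B
  proof -
    have "B' = B" if "B' \<in> P" "x \<in> B" "x \<in> B'" for B' x
      using partition_onD2[OF P] \<open>B \<in> P\<close> that unfolding disjoint_def by blast
    with that show ?thesis unfolding S_def by blast
  qed
  have S: "S \<in> sets M"
  proof (rule meas[THEN iffD2])
    show "S \<subseteq> space M" using partition_onD1[OF P] unfolding S_def by blast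
    show "\<forall>B\<in>P. S \<inter> B \<in> sets M"
    proof
      fix B assume B: "B \<in> P"
      show "S \<inter> B \<in> sets M" unfolding SB[OF B] using fin[OF B] cs[OF B] by (intro sets.Int) simp_all
    qed
  qed
  show thesis
  proof
    show "S \<in> sets M" by fact
  next
    fix A assume A: "A \<in> F"
    show "A - S \<in> null_sets M"
    proof (rule nullI)
      fix B assume B: "B \<in> P"
      have "(A - S) \<inter> B = A \<inter> B - \<Union>(c B)" using SB[OF B] by blast
      then show "(A - S) \<inter> B \<in> null_sets M" using c(3)[OF B A] by simp
    qed (use A F S in blast)
  next
    fix T assume T: "T \<in> sets M" "\<And>A. A \<in> F \<Longrightarrow> A - T \<in> null_sets M"
    show "S - T \<in> null_sets M"
    proof (rule nullI)
      fix B assume B: "B \<in> P"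
      \<comment> \<open>Inside \<open>B\<close>, the set \<open>S\<close> is covered by countably
        many members of \<open>F\<close>, each of which exceeds \<open>T\<close> by a null set
        only.\<close>
      have "(\<Union>A\<in>c B. A - T) \<in> null_sets M"
        using c(1,2)[OF B] T(2) by (intro null_sets_UN') blast+
      moreover have "(S - T) \<inter> B \<subseteq> (\<Union>A\<in>c B. A - T)" using SB[OF B] by blast
      moreover have "(S - T) \<inter> B \<in> sets M" using S T(1) fin[OF B] by blast
      ultimately show "(S - T) \<inter> B \<in> null_sets M" using null_sets_subset by blast
    qed (use S T(1) in blast)
  qed
qed

text \<open>Take the complement of the essential supremum of the complements.\<close>

lemma strictly_localizable_ess_inf_exists:
  assumes sl: "strictly_localizable M" and F: "F \<subseteq> sets M"
  obtains S where "S \<in> sets M" "\<And>A. A \<in> F \<Longrightarrow> S - A \<in> null_sets M"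
    "\<And>T. T \<in> sets M \<Longrightarrow> (\<And>A. A \<in> F \<Longrightarrow> T - A \<in> null_sets M) \<Longrightarrow> T - S \<in> null_sets M"
proof -
  have sub: "A \<subseteq> space M" if "A \<in> sets M" for A using that by (rule sets.sets_into_space)
  have "(\<lambda>A. space M - A) ` F \<subseteq> sets M" using F by auto
  from strictly_localizable_ess_sup_exists[OF sl this] obtain S where S: "S \<in> sets M"
    "\<And>A. A \<in> (\<lambda>A. space M - A) ` F \<Longrightarrow> A - S \<in> null_sets M"
    "\<And>T. T \<in> sets M \<Longrightarrow> (\<And>A. A \<in> (\<lambda>A. space M - A) ` F \<Longrightarrow> A - T \<in> null_sets M) \<Longrightarrow>
      S - T \<in> null_sets M"
    by blast
  show thesis
  proof
    show "space M - S \<in> sets M" using S(1) by auto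
    show "space M - S - A \<in> null_sets M" if "A \<in> F" for A
      using S(2)[OF imageI[OF that]] by (simp add: Diff_eq Int_ac)
    show "T - (space M - S) \<in> null_sets M"
      if T: "T \<in> sets M" "\<And>A. A \<in> F \<Longrightarrow> T - A \<in> null_sets M" for T
    proof -
      have "S - (space M - T) \<in> null_sets M"
      proof (rule S(3))
        fix B assume "B \<in> (\<lambda>A. space M - A) ` F"
        then obtain A where A: "A \<in> F" "B = space M - A" by blast
        have "B - (space M - T) = T - A" using sub[OF T(1)] A(2) by blast
        then show "B - (space M - T) \<in> null_sets M" using T(2)[OF A(1)] by simp
      qed (use T(1) in auto)
      moreover have "S - (space M - T) = T - (space M - S)" using sub[OF T(1)] sub[OF S(1)] by auto
      ultimately show ?thesis by simp
    qed
  qed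
qed

text \<open>This makes the operations \<open>\<Squnion>\<close> and \<open>\<Sqinter>\<close>
  genuine suprema and infima, as both semicontinuity notions presuppose.\<close>

lemma complete_lattice_measure_algebra:
  assumes sl: "strictly_localizable M"
  shows "complete_lattice (measure_algebra M)"
proof (rule partial_order.complete_latticeI[OF partial_order_measure_algebra])
  fix X assume X: "X \<subseteq> carrier (measure_algebra M)"
  define F where "F = {A \<in> sets M. mclass M A \<in> X}"
  have F: "F \<subseteq> sets M" by (auto simp: F_def)
  have XF: "X = mclass M ` F" using X by (auto simp: F_def carrier_measure_algebra)
  have "Upper (measure_algebra M) X = {u \<in> carrier (measure_algebra M). \<forall>x\<in>X. x \<sqsubseteq>\<^bsub>measure_algebra M\<^esub> u}"
    and "Lower (measure_algebra M) X = {l \<in> carrier (measure_algebra M). \<forall>x\<in>X. l \<sqsubseteq>\<^bsub>measure_algebra M\<^esub> x}"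
    using X unfolding Upper_def Lower_def by blast+
  moreover have "A \<in> sets M" if "A \<in> F" for A using that F by blast
  ultimately
  have Upper: "mclass M T \<in> Upper (measure_algebra M) X \<longleftrightarrow> (\<forall>A\<in>F. A - T \<in> null_sets M)"
    and Lower: "mclass M T \<in> Lower (measure_algebra M) X \<longleftrightarrow> (\<forall>A\<in>F. T - A \<in> null_sets M)"
    if "T \<in> sets M" for T
    using that by (simp_all add: XF le_mclass_iff) (simp_all add: carrier_measure_algebra)
  from strictly_localizable_ess_sup_exists[OF sl F] obtain S where S: "S \<in> sets M"
    "\<And>A. A \<in> F \<Longrightarrow> A - S \<in> null_sets M"
    "\<And>T. T \<in> sets M \<Longrightarrow> (\<And>A. A \<in> F \<Longrightarrow> A - T \<in> null_sets M) \<Longrightarrow> S - T \<in> null_sets M"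
    by blast
  have "least (measure_algebra M) (mclass M S) (Upper (measure_algebra M) X)"
    unfolding least_def
  proof (intro conjI ballI)
    show "mclass M S \<in> Upper (measure_algebra M) X" using S by (simp add: Upper)
    fix x assume x: "x \<in> Upper (measure_algebra M) X"
    then have "x \<in> carrier (measure_algebra M)" by (auto simp: Upper_def)
    then obtain T where "T \<in> sets M" "x = mclass M T" by (auto simp: carrier_measure_algebra)
    then show "mclass M S \<sqsubseteq>\<^bsub>measure_algebra M\<^esub> x" using S x by (simp add: Upper le_mclass_iff)
  qed simp
  then show "\<exists>s. least (measure_algebra M) s (Upper (measure_algebra M) X)" ..
  from strictly_localizable_ess_inf_exists[OF sl F] obtain S where S: "S \<in> sets M"
    "\<And>A. A \<in> F \<Longrightarrow> S - A \<in> null_sets M"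
    "\<And>T. T \<in> sets M \<Longrightarrow> (\<And>A. A \<in> F \<Longrightarrow> T - A \<in> null_sets M) \<Longrightarrow> T - S \<in> null_sets M"
    by blast
  have "greatest (measure_algebra M) (mclass M S) (Lower (measure_algebra M) X)"
    unfolding greatest_def
  proof (intro conjI ballI)
    show "mclass M S \<in> Lower (measure_algebra M) X" using S by (simp add: Lower)
    fix x assume x: "x \<in> Lower (measure_algebra M) X"
    then have "x \<in> carrier (measure_algebra M)" by (auto simp: Lower_def)
    then obtain T where "T \<in> sets M" "x = mclass M T" by (auto simp: carrier_measure_algebra)
    then show "x \<sqsubseteq>\<^bsub>measure_algebra M\<^esub> mclass M S" using S x by (simp add: Lower le_mclass_iff)
  qed simp
  then show "\<exists>i. greatest (measure_algebra M) i (Lower (measure_algebra M) X)" ..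
qed

section \<open>Semicontinuity in terms of representatives\<close>

context complete_lattice
begin

text \<open>Removes the lattice operations. By \<open>j0\<close> every infimum lies below
  \<open>a\<close>, so only the inequality from \<open>a\<close> to the supremum is at stake. It is
  tested against all upper bounds \<open>b\<close> of the infima, and an infimum lies below
  \<open>b\<close> iff all lower bounds \<open>c\<close> of its family do.\<close>

lemma eq_sup_inf_iff:
  assumes g: "\<And>i j. i \<in> I \<Longrightarrow> j \<in> J i \<Longrightarrow> g j \<in> carrier L" and a: "a \<in> carrier L"
    and j0: "\<And>i. i \<in> I \<Longrightarrow> \<exists>j\<in>J i. g j = a"
  shows "a = \<Squnion>((\<lambda>i. \<Sqinter>(g ` J i)) ` I) \<longleftrightarrow>
    (\<forall>b\<in>carrier L. (\<forall>i\<in>I. \<forall>c\<in>carrier L. (\<forall>j\<in>J i. c \<sqsubseteq> g j) \<longrightarrow> c \<sqsubseteq> b) \<longrightarrow> a \<sqsubseteq> b)"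
proof -
  let ?S = "(\<lambda>i. \<Sqinter>(g ` J i)) ` I"
  have gJ: "g ` J i \<subseteq> carrier L" if "i \<in> I" for i using g that by blast
  have S: "?S \<subseteq> carrier L" using gJ by auto
  have inf_le_iff: "\<Sqinter>(g ` J i) \<sqsubseteq> b \<longleftrightarrow>
      (\<forall>c\<in>carrier L. (\<forall>j\<in>J i. c \<sqsubseteq> g j) \<longrightarrow> c \<sqsubseteq> b)" if i: "i \<in> I" and b: "b \<in> carrier L" for i b
  proof safe
    fix c assume "\<Sqinter>(g ` J i) \<sqsubseteq> b" and c: "c \<in> carrier L" "\<forall>j\<in>J i. c \<sqsubseteq> g j"
    moreover have "c \<sqsubseteq> \<Sqinter>(g ` J i)" using c gJ[OF i] by (intro inf_greatest) auto
    ultimately show "c \<sqsubseteq> b" using c(1) b gJ[OF i] le_trans by (meson inf_closed)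
  next
    assume *: "\<forall>c\<in>carrier L. (\<forall>j\<in>J i. c \<sqsubseteq> g j) \<longrightarrow> c \<sqsubseteq> b"
    have "\<Sqinter>(g ` J i) \<sqsubseteq> g j" if "j \<in> J i" for j using gJ[OF i] that by (intro inf_lower) auto
    with * show "\<Sqinter>(g ` J i) \<sqsubseteq> b" using gJ[OF i] by auto
  qed
  have Sa: "\<Squnion>?S \<sqsubseteq> a"
  proof (rule sup_least[OF S a])
    fix x assume "x \<in> ?S"
    then obtain i where i: "i \<in> I" "x = \<Sqinter>(g ` J i)" by blast
    with j0 obtain j where "j \<in> J i" "g j = a" by blast
    then show "x \<sqsubseteq> a" using inf_lower[OF gJ[OF i(1)]] i(2) by blast
  qed
  show ?thesis
  proof
    assume eq: "a = \<Squnion>?S"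
    show "\<forall>b\<in>carrier L. (\<forall>i\<in>I. \<forall>c\<in>carrier L. (\<forall>j\<in>J i. c \<sqsubseteq> g j) \<longrightarrow> c \<sqsubseteq> b) \<longrightarrow> a \<sqsubseteq> b"
    proof (intro ballI impI)
      fix b assume b: "b \<in> carrier L"
        and "\<forall>i\<in>I. \<forall>c\<in>carrier L. (\<forall>j\<in>J i. c \<sqsubseteq> g j) \<longrightarrow> c \<sqsubseteq> b"
      then show "a \<sqsubseteq> b" unfolding eq by (intro sup_least[OF S b]) (auto simp: inf_le_iff)
    qed
  next
    assume *: "\<forall>b\<in>carrier L. (\<forall>i\<in>I. \<forall>c\<in>carrier L. (\<forall>j\<in>J i. c \<sqsubseteq> g j) \<longrightarrow> c \<sqsubseteq> b) \<longrightarrow> a \<sqsubseteq> b"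
    have "\<Sqinter>(g ` J i) \<sqsubseteq> \<Squnion>?S" if "i \<in> I" for i using S that by (intro sup_upper) auto
    then have "a \<sqsubseteq> \<Squnion>?S" using * S by (simp add: inf_le_iff sup_closed)
    then show "a = \<Squnion>?S" using Sa a S by (intro le_antisym) auto
  qed
qed

end

lemma dual_complete_lattice: "complete_lattice L \<Longrightarrow> complete_lattice (inv_gorder L)"
  by (simp add: complete_lattice_def complete_lattice_axioms_def partial_order.dual_order)

text \<open>\<open>g s\<close> represents the translated class; the unit, present in every
  \<open>V\<close>, provides the premise \<open>j0\<close> of \<open>eq_sup_inf_iff\<close>.\<close>

lemma lower_semicontinuous_at_mclass_iff:
  assumes "strictly_localizable M" and "A \<in> sets M" and "\<And>s. g s \<in> sets M" and "g 0 = A"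
    and "\<And>s. act s (mclass M A) = mclass M (g s)"
  shows "lower_semicontinuous_at (measure_algebra M) act (mclass M A) \<longleftrightarrow>
    (\<forall>B\<in>sets M. (\<forall>V\<in>unit_nhds. \<forall>C\<in>sets M.
       (\<forall>s\<in>V. C - g s \<in> null_sets M) \<longrightarrow> C - B \<in> null_sets M) \<longrightarrow> A - B \<in> null_sets M)"
proof -
  interpret complete_lattice "measure_algebra M"
    using assms(1) by (rule complete_lattice_measure_algebra)
  have "act s (mclass M A) \<in> carrier (measure_algebra M)" for s
    using assms(3,5) by (simp add: carrier_measure_algebra)
  moreover have "mclass M A \<in> carrier (measure_algebra M)"
    using assms(2) by (simp add: carrier_measure_algebra)
  moreover have "\<exists>s\<in>V. act s (mclass M A) = mclass M A" if "V \<in> unit_nhds" for V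
    using that assms(4,5) by (auto simp: unit_nhds_def)
  ultimately show ?thesis
    unfolding lower_semicontinuous_at_def using assms(2,3,5)
    by (subst eq_sup_inf_iff) (simp_all add: carrier_measure_algebra le_mclass_iff)
qed

text \<open>This is \<open>eq_sup_inf_iff\<close> read in the dual order, where suprema and infima
  change places.\<close>

lemma upper_semicontinuous_at_mclass_iff:
  assumes "strictly_localizable M" and "A \<in> sets M" and "\<And>s. g s \<in> sets M" and "g 0 = A"
    and "\<And>s. act s (mclass M A) = mclass M (g s)"
  shows "upper_semicontinuous_at (measure_algebra M) act (mclass M A) \<longleftrightarrow>
    (\<forall>B\<in>sets M. (\<forall>V\<in>unit_nhds. \<forall>C\<in>sets M.
       (\<forall>s\<in>V. g s - C \<in> null_sets M) \<longrightarrow> B - C \<in> null_sets M) \<longrightarrow> B - A \<in> null_sets M)"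
proof -
  interpret dual: complete_lattice "inv_gorder (measure_algebra M)"
    using assms(1) by (intro dual_complete_lattice complete_lattice_measure_algebra)
  have "act s (mclass M A) \<in> carrier (measure_algebra M)" for s
    using assms(3,5) by (simp add: carrier_measure_algebra)
  moreover have "mclass M A \<in> carrier (measure_algebra M)"
    using assms(2) by (simp add: carrier_measure_algebra)
  moreover have "\<exists>s\<in>V. act s (mclass M A) = mclass M A" if "V \<in> unit_nhds" for V
    using that assms(4,5) by (auto simp: unit_nhds_def)
  ultimately have "mclass M A = \<Sqinter>\<^bsub>measure_algebra M\<^esub> ((\<lambda>V. \<Squnion>\<^bsub>measure_algebra M\<^esub> ((\<lambda>s. act s (mclass M A)) ` V)) ` unit_nhds) \<longleftrightarrow>
    (\<forall>b\<in>carrier (measure_algebra M). (\<forall>V\<in>unit_nhds. \<forall>c\<in>carrier (measure_algebra M).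
       (\<forall>s\<in>V. act s (mclass M A) \<sqsubseteq>\<^bsub>measure_algebra M\<^esub> c) \<longrightarrow> b \<sqsubseteq>\<^bsub>measure_algebra M\<^esub> c) \<longrightarrow> b \<sqsubseteq>\<^bsub>measure_algebra M\<^esub> mclass M A)"
    using dual.eq_sup_inf_iff[of unit_nhds "\<lambda>V. V" "\<lambda>s. act s (mclass M A)" "mclass M A"]
    by simp
  then show ?thesis
    unfolding upper_semicontinuous_at_def using assms(2,3,5)
    by (simp add: carrier_measure_algebra le_mclass_iff)
qed

section \<open>Haar measures: compact sets, null sets and inversion\<close>

locale haar =
  fixes M :: "'a::{topological_group_add, t2_space} measure"
  assumes locally_compact: "locally_compact_space (euclidean :: 'a topology)"
    and haar: "left_haar_measure M"
begin

lemma space_eq_UNIV: "space M = UNIV"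
  and borel_subset: "sets borel \<subseteq> sets M"
  and localizable: "strictly_localizable M"
  and nonzero: "emeasure M UNIV \<noteq> 0"
  and emeasure_compact: "compact K \<Longrightarrow> emeasure M K < \<infinity>"
  and inner_regular: "A \<in> sets M \<Longrightarrow> emeasure M A = (SUP K\<in>{K. compact K \<and> K \<subseteq> A}. emeasure M K)"
  and translate_sets: "A \<in> sets M \<Longrightarrow> (\<lambda>x. s + x) ` A \<in> sets M"
  and emeasure_translate: "A \<in> sets M \<Longrightarrow> emeasure M ((\<lambda>x. s + x) ` A) = emeasure M A"
  using haar unfolding left_haar_measure_def by (elim conjE; (assumption | metis))+

sublocale complete_measure M
  using haar unfolding left_haar_measure_def by (elim conjE)

lemma translate_null: "N \<in> null_sets M \<Longrightarrow> (\<lambda>x. s + x) ` N \<in> null_sets M"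
  by (simp add: null_sets_def translate_sets emeasure_translate)

lemma open_sets [intro]: "open U \<Longrightarrow> U \<in> sets M"
  and closed_sets [intro]: "closed U \<Longrightarrow> U \<in> sets M"
  and compact_sets [intro]: "compact U \<Longrightarrow> U \<in> sets M"
  using borel_subset borel_compact[of U] by auto

lemma compact_neighbourhood:
  fixes x :: 'a
  shows "\<exists>U K. open U \<and> compact K \<and> x \<in> U \<and> U \<subseteq> K"
  using locally_compact by (simp add: locally_compact_space_def)

lemma null_sets_if_compact:
  assumes "A \<in> sets M" "\<And>K. compact K \<Longrightarrow> K \<subseteq> A \<Longrightarrow> K \<in> null_sets M"
  shows "A \<in> null_sets M"
proof (rule null_setsI)
  have "emeasure M A \<le> 0"
    unfolding inner_regular[OF assms(1)] using assms(2) by (intro SUP_least) auto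
  then show "emeasure M A = 0" by simp
qed fact

text \<open>Inner regularity supplies countably many compact subsets whose measures have supremum
  \<open>emeasure M A\<close>; as this is finite, what they leave out is null.\<close>

lemma inner_sigma_compact:
  assumes A: "A \<in> sets M" "emeasure M A < \<infinity>"
  obtains K :: "nat \<Rightarrow> 'a set" where "\<And>n. compact (K n)" "\<And>n. K n \<subseteq> A" "A - (\<Union>n. K n) \<in> null_sets M"
proof -
  let ?I = "{K. compact K \<and> K \<subseteq> A}"
  have "{} \<in> ?I" by simp
  then have "?I \<noteq> {}" by blast
  from ennreal_SUP_countable_SUP[OF this, of "emeasure M"]
  obtain f :: "nat \<Rightarrow> ennreal" where f: "range f \<subseteq> emeasure M ` ?I" "Sup (emeasure M ` ?I) = Sup (range f)"
    by blast
  then have "\<forall>n. \<exists>K\<in>?I. f n = emeasure M K" by blast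
  then obtain K where K: "\<And>n. K n \<in> ?I" "\<And>n. f n = emeasure M (K n)" by metis
  show thesis
  proof
    show "compact (K n)" "K n \<subseteq> A" for n using K(1) by auto
    have meas: "(\<Union>n. K n) \<in> sets M" using K(1) by (intro sets.countable_UN) auto
    have sub: "(\<Union>n. K n) \<subseteq> A" using K(1) by auto
    have "emeasure M A \<le> emeasure M (\<Union>n. K n)"
      unfolding inner_regular[OF A(1)] f(2) K(2) using meas by (intro SUP_least emeasure_mono) auto
    moreover have "emeasure M (\<Union>n. K n) \<noteq> \<infinity>"
      using emeasure_mono[OF sub A(1)] A(2) by (auto simp: top_unique)
    ultimately have "emeasure M (A - (\<Union>n. K n)) = 0"
      using emeasure_Diff[OF _ A(1) meas sub] A(2) by (auto intro: diff_eq_0_ennreal)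
    then show "A - (\<Union>n. K n) \<in> null_sets M" using A(1) meas by (intro null_setsI) auto
  qed
qed

text \<open>A block of the localizing partition has finite measure, hence is a countable union of
  compact sets up to a null set, and completeness makes every part of that null set
  measurable.\<close>

lemma sets_if_compact:
  assumes "\<And>K. compact K \<Longrightarrow> A \<inter> K \<in> sets M"
  shows "A \<in> sets M"
proof -
  from localizable obtain P where *: "partition_on (space M) P \<and>
      (\<forall>B\<in>P. B \<in> sets M \<and> emeasure M B < \<infinity>) \<and>
      (\<forall>Z. Z \<subseteq> space M \<longrightarrow> (Z \<in> sets M \<longleftrightarrow> (\<forall>B\<in>P. Z \<inter> B \<in> sets M))) \<and>
      (\<forall>Z\<in>sets M. emeasure M Z = (\<Sum>\<^sub>\<infinity>B\<in>P. emeasure M (Z \<inter> B)))"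
    unfolding strictly_localizable_def by (rule exE)
  have "A \<inter> B \<in> sets M" if "B \<in> P" for B
  proof -
    have "B \<in> sets M" "emeasure M B < \<infinity>" using * that by blast+
    then obtain K :: "nat \<Rightarrow> 'a set" where K: "\<And>n. compact (K n)" "\<And>n. K n \<subseteq> B"
      "B - (\<Union>n. K n) \<in> null_sets M"
      using inner_sigma_compact by blast
    have "A \<inter> (B - (\<Union>n. K n)) \<in> null_sets M" using K(3) by (rule complete2[rotated]) auto
    then have "(\<Union>n. A \<inter> K n) \<union> A \<inter> (B - (\<Union>n. K n)) \<in> sets M"
      using assms K(1) by (intro sets.Un sets.countable_UN) auto
    also have "(\<Union>n. A \<inter> K n) \<union> A \<inter> (B - (\<Union>n. K n)) = A \<inter> B" using K(2) by blast
    finally show ?thesis .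
  qed
  then show ?thesis using * space_eq_UNIV by (metis subset_UNIV)
qed

text \<open>Outer regularity may fail for other null sets, but compactness gives an open
  \<open>W\<close> of finite measure around \<open>K\<close>. Removing from \<open>W\<close> more
  and more of the compact sets that exhaust \<open>W - K\<close> leaves open sets whose measures
  tend to 0.\<close>

lemma compact_null_outer:
  fixes e :: ennreal
  assumes K: "compact K" "K \<in> null_sets M" and e: "e > 0"
  obtains U where "open U" "K \<subseteq> U" "emeasure M U < e"
proof -
  obtain U C :: "'a \<Rightarrow> 'a set" where UC: "\<And>x. open (U x)" "\<And>x. compact (C x)" "\<And>x. x \<in> U x" "\<And>x. U x \<subseteq> C x"
    using compact_neighbourhood by metis
  have "K \<subseteq> (\<Union>x\<in>K. U x)" using UC(3) by blast
  then obtain T where T: "T \<subseteq> K" "finite T" "K \<subseteq> (\<Union>x\<in>T. U x)"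
    using compactE_image[OF K(1), of K U] UC(1) by blast
  define W where "W = (\<Union>x\<in>T. U x)"
  have W: "open W" "K \<subseteq> W" using UC(1) T by (auto simp: W_def)
  have "compact (\<Union>x\<in>T. C x)" using T(2) UC(2) by (intro compact_UN)
  moreover have "W \<subseteq> (\<Union>x\<in>T. C x)" using UC(4) by (auto simp: W_def)
  ultimately have finW: "emeasure M W < \<infinity>"
    using emeasure_mono[of W "\<Union>x\<in>T. C x" M] emeasure_compact[of "\<Union>x\<in>T. C x"]
    by (auto intro: le_less_trans)
  have "emeasure M (W - K) < \<infinity>"
    using emeasure_mono[of "W - K" W M] W(1) finW by (auto intro: le_less_trans)
  moreover have "W - K \<in> sets M" using W K by auto
  ultimately obtain F :: "nat \<Rightarrow> 'a set" where F: "\<And>n. compact (F n)" "\<And>n. F n \<subseteq> W - K"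
    "W - K - (\<Union>n. F n) \<in> null_sets M" using inner_sigma_compact by blast
  define V where "V n = W - (\<Union>i\<le>n. F i)" for n
  have V: "open (V n)" "K \<subseteq> V n" "V n \<subseteq> W" for n
    using W F compact_UN[of "{..n}" F] by (auto simp: V_def intro!: open_Diff compact_imp_closed)
  have "(\<lambda>n. emeasure M (V n)) \<longlonglongrightarrow> emeasure M (\<Inter>n. V n)"
  proof (rule Lim_emeasure_decseq)
    show "decseq V" unfolding V_def decseq_def by (auto; meson order_trans)
    show "emeasure M (V i) \<noteq> \<infinity>" for i
      using emeasure_mono[OF V(3)[of i] open_sets[OF W(1)]] finW by (auto simp: top_unique)
  qed (use V in auto)
  moreover have "emeasure M (\<Inter>n. V n) = 0"
  proof -
    have "(\<Inter>n. V n) = (W - K - (\<Union>n. F n)) \<union> K"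
      using W(2) F(2) unfolding V_def by blast
    then show ?thesis using null_setsD1[OF null_sets.Un[OF F(3) K(2)]] by simp
  qed
  ultimately have "(\<lambda>n. emeasure M (V n)) \<longlonglongrightarrow> 0" by simp
  then have "\<forall>\<^sub>F n in sequentially. emeasure M (V n) < e" using e by (rule order_tendstoD)
  then obtain n where "emeasure M (V n) < e" by (auto simp: eventually_sequentially)
  with V that show thesis by blast
qed

lemma ex_compact_nonnull:
  obtains F where "compact F" "F \<notin> null_sets M"
proof -
  have "UNIV \<notin> null_sets M" "UNIV \<in> sets M" using nonzero by auto
  with null_sets_if_compact that show thesis by blast
qed

text \<open>Otherwise finitely many open sets with null trace on \<open>K\<close> would cover
  \<open>K\<close>.\<close>

lemma nonnull_compact_point:
  assumes "compact K" "K \<notin> null_sets M"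
  obtains x where "x \<in> K" "\<And>U. open U \<Longrightarrow> x \<in> U \<Longrightarrow> K \<inter> U \<notin> null_sets M"
proof (rule ccontr)
  assume "\<not> thesis"
  with that have "\<forall>x\<in>K. \<exists>U. open U \<and> x \<in> U \<and> K \<inter> U \<in> null_sets M" by blast
  then obtain U where U: "\<And>x. x \<in> K \<Longrightarrow> open (U x) \<and> x \<in> U x \<and> K \<inter> U x \<in> null_sets M" by metis
  then have "K \<subseteq> (\<Union>x\<in>K. U x)" by blast
  then obtain T where T: "T \<subseteq> K" "finite T" "K \<subseteq> (\<Union>x\<in>T. U x)"
    using compactE_image[OF assms(1), of K U] U by blast
  have "(\<Union>x\<in>T. K \<inter> U x) \<in> null_sets M" using T U by (intro null_sets.finite_UN) auto
  moreover have "(\<Union>x\<in>T. K \<inter> U x) = K" using T(3) by blast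
  ultimately show False using assms(2) by simp
qed

text \<open>A Fubini argument for the compact set of pairs \<open>(s, y)\<close> with \<open>y \<in> (s + L) \<inter> F\<close>, whose
  sections at \<open>y\<close> are the sets \<open>y - L\<close>.  As this set need not be measurable for the product of the
  Borel \<open>\<sigma>\<close>-algebras, it is covered by finitely many rectangles.\<close>

lemma uminus_null_if_translates_null:
  assumes L: "compact L" and F: "compact F" "F \<notin> null_sets M"
    and null: "\<And>s. (\<lambda>x. s + x) ` L \<inter> F \<in> null_sets M"
  shows "uminus ` L \<in> null_sets M"
proof -
  define E where "E = (\<lambda>(y, l). y - l) ` (F \<times> L)"
  have cont_diff: "continuous_on S (\<lambda>(y, l). y - l)" for S :: "('a \<times> 'a) set"
    by (auto simp: case_prod_unfold diff_conv_add_uminus simp del: add_uminus_conv_diff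
        intro!: continuous_intros)
  have E: "compact E"
    unfolding E_def by (intro compact_continuous_image compact_Times L F cont_diff)
  have negL: "compact (uminus ` L)" by (intro compact_continuous_image L continuous_intros)
  have bound: "emeasure M (uminus ` L) * emeasure M F \<le> emeasure M E * e" if e: "e > 0" for e :: ennreal
  proof -
    have "\<exists>U. open U \<and> (\<lambda>x. s + x) ` L \<inter> F \<subseteq> U \<and> emeasure M U < e" for s
    proof -
      have "compact ((\<lambda>x. s + x) ` L \<inter> F)"
        by (intro compact_Int compact_continuous_image L F continuous_intros)
      then obtain U where "open U" "(\<lambda>x. s + x) ` L \<inter> F \<subseteq> U" "emeasure M U < e"
        using null e by (rule compact_null_outer)
      then show ?thesis by blast
    qed
    then obtain U where U: "\<And>s. open (U s)" "\<And>s. (\<lambda>x. s + x) ` L \<inter> F \<subseteq> U s"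
      "\<And>s. emeasure M (U s) < e" by metis
    \<comment> \<open>The removed set is compact and consists of the \<open>t\<close> for which
      \<open>t + L\<close> meets \<open>F - U s\<close>. So \<open>N s\<close> is an open
      neighbourhood of \<open>s\<close>, all of whose elements \<open>t\<close> satisfy
      \<open>(t + L) \<inter> F \<subseteq> U s\<close>: the rectangle is
      \<open>N s \<times> U s\<close>.\<close>
    define N where "N s = - ((\<lambda>(y, l). y - l) ` ((F - U s) \<times> L))" for s
    have N: "open (N s)" for s
      unfolding N_def
      by (intro open_Compl compact_imp_closed compact_continuous_image compact_Times L cont_diff
          compact_diff F U)
    have sN: "s \<in> N s" for s
      using U(2)[of s] by (force simp: N_def image_iff)
    have NU: "t + l \<in> U s" if "t \<in> N s" "l \<in> L" "t + l \<in> F" for s t l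
      using that by (force simp: N_def image_iff)
    have "E \<subseteq> (\<Union>s\<in>E. N s)" using sN by blast
    then obtain T where T: "T \<subseteq> E" "finite T" "E \<subseteq> (\<Union>s\<in>T. N s)"
      using compactE_image[OF E, of E N] N by blast
    obtain n :: nat and t where t: "T = t ` {0..<n}"
      using finite_imp_nat_seg_image_inj_on[OF T(2)] by (auto simp: lessThan_def[symmetric] atLeast0LessThan)
    \<comment> \<open>Making the first sides disjoint lets their measures add up to exactly that of
      \<open>E\<close>.\<close>
    define D where "D = disjointed (\<lambda>i. E \<inter> N (t i))"
    have D_sets: "D i \<in> sets M" for i
      using sets.range_disjointed_sets[of "\<lambda>i. E \<inter> N (t i)"] E N unfolding D_def by auto
    have D_sub: "D i \<subseteq> N (t i)" for i
      using disjointed_subset[of "\<lambda>i. E \<inter> N (t i)" i] by (auto simp: D_def)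
    have D_UN: "(\<Union>i\<in>{0..<n}. D i) = E"
      unfolding D_def finite_UN_disjointed_eq using T(3) t by auto
    have "disjoint_family_on D {0..<n}"
      unfolding D_def by (rule disjoint_family_on_mono[OF subset_UNIV disjoint_family_disjointed])
    then have D_sum: "(\<Sum>i\<in>{0..<n}. emeasure M (D i)) = emeasure M E"
      using sum_emeasure[of D "{0..<n}" M] D_sets D_UN by auto
    have U_sets [measurable]: "U s \<in> sets M" for s using U(1) by (rule open_sets)
    \<comment> \<open>The section at \<open>y \<in> F\<close> is the left translate by
      \<open>y\<close> of the inverse of \<open>L\<close>, so its measure does not depend on
      \<open>y\<close>; it is covered by those \<open>D i\<close> with
      \<open>y \<in> U (t i)\<close>.\<close>
    have "emeasure M (uminus ` L) * indicator F y \<le>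
        (\<Sum>i\<in>{0..<n}. emeasure M (D i) * indicator (U (t i)) y)" for y
    proof (cases "y \<in> F")
      case True
      define I where "I = {i\<in>{0..<n}. y \<in> U (t i)}"
      have "(\<lambda>x. y + x) ` uminus ` L \<subseteq> (\<Union>i\<in>I. D i)"
      proof
        fix s assume "s \<in> (\<lambda>x. y + x) ` uminus ` L"
        then obtain l where l: "l \<in> L" "s = y - l" by auto
        then have "s \<in> E" using True by (auto simp: E_def)
        then obtain i where i: "i \<in> {0..<n}" "s \<in> D i" using D_UN by blast
        have "y = s + l" using l by simp
        then have "y \<in> U (t i)" using NU[of s "t i" l] i(2) D_sub l(1) True by auto
        then show "s \<in> (\<Union>i\<in>I. D i)" using i by (auto simp: I_def)
      qed
      then have "emeasure M (uminus ` L) \<le> emeasure M (\<Union>i\<in>I. D i)"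
        using emeasure_mono[of "(\<lambda>x. y + x) ` uminus ` L" "\<Union>i\<in>I. D i" M] D_sets
          emeasure_translate[OF compact_sets[OF negL], of y] by (auto simp: I_def)
      also have "\<dots> \<le> (\<Sum>i\<in>I. emeasure M (D i))"
        using D_sets by (intro emeasure_subadditive_finite) (auto simp: I_def)
      also have "\<dots> = (\<Sum>i\<in>{0..<n}. emeasure M (D i) * indicator (U (t i)) y)"
        unfolding I_def by (intro sum.mono_neutral_cong_left) (auto simp: indicator_def)
      finally show ?thesis using True by simp
    qed simp
    then have "(\<integral>\<^sup>+y. emeasure M (uminus ` L) * indicator F y \<partial>M) \<le>
        (\<integral>\<^sup>+y. (\<Sum>i\<in>{0..<n}. emeasure M (D i) * indicator (U (t i)) y) \<partial>M)"
      by (intro nn_integral_mono)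
    also have "\<dots> = (\<Sum>i\<in>{0..<n}. emeasure M (D i) * emeasure M (U (t i)))"
      by (subst nn_integral_sum) (simp_all only: nn_integral_cmult_indicator U_sets, measurable)
    also have "\<dots> \<le> (\<Sum>i\<in>{0..<n}. emeasure M (D i) * e)"
      by (intro sum_mono mult_left_mono less_imp_le[OF U(3)]) simp
    also have "\<dots> = emeasure M E * e"
      by (simp add: D_sum flip: sum_distrib_right)
    finally show ?thesis unfolding nn_integral_cmult_indicator[OF compact_sets[OF F(1)]] .
  qed
  \<comment> \<open>As \<open>E\<close> has finite measure, letting \<open>e\<close> run through
    \<open>1 / (n + 1)\<close> reduces the bound to 0.\<close>
  have "(\<lambda>n. emeasure M E * ennreal (inverse (real (Suc n)))) \<longlonglongrightarrow> emeasure M E * ennreal 0"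
    using emeasure_compact[OF E]
    by (intro ennreal_tendsto_cmult tendsto_ennrealI LIMSEQ_inverse_real_of_nat) simp
  then have "emeasure M (uminus ` L) * emeasure M F \<le> emeasure M E * ennreal 0"
    by (rule LIMSEQ_le_const) (intro exI allI impI bound, simp)
  then have "emeasure M (uminus ` L) = 0"
    using F null_setsI[OF _ compact_sets[OF F(1)]] by auto
  then show ?thesis using negL by (intro null_setsI compact_sets)
qed

section \<open>Inversion and right translations\<close>

lemma uminus_uminus_image: "uminus ` uminus ` A = (A :: 'a set)"
  by (simp add: image_image)

lemma compact_uminus: "compact K \<Longrightarrow> compact (uminus ` K :: 'a set)"
  by (intro compact_continuous_image continuous_intros)

text \<open>Translates of the null set \<open>K\<close> are null, so the Fubini argument applies
  with any non-null compact \<open>F\<close>.\<close>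

lemma uminus_null_compact:
  assumes "compact K" "K \<in> null_sets M"
  shows "uminus ` K \<in> null_sets M"
proof -
  obtain F where F: "compact F" "F \<notin> null_sets M" by (rule ex_compact_nonnull)
  show ?thesis
    by (intro uminus_null_if_translates_null[OF assms(1) F] null_set_Int2 translate_null assms
        compact_sets F)
qed

text \<open>The difficulty is measurability of the inverse, which is checked inside each compact
  set. There the relevant part of \<open>N\<close> is enlarged to a null set \<open>D\<close> that
  is a compact set minus a sigma-compact one, so the inverse of \<open>D\<close> is Borel; its
  compact subsets are null by \<open>uminus_null_compact\<close>.\<close>

lemma uminus_null:
  assumes N: "N \<in> null_sets M"
  shows "uminus ` N \<in> null_sets M"
proof -
  have "uminus ` N \<inter> K \<in> sets M" if K: "compact K" for K
  proof -
    let ?K = "uminus ` K"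
    have cK: "compact ?K" using K by (rule compact_uminus)
    have "?K - N \<in> sets M" using cK N by auto
    moreover have "emeasure M (?K - N) < \<infinity>"
      using emeasure_mono[of "?K - N" ?K M] cK emeasure_compact[OF cK] by (auto intro: le_less_trans)
    ultimately obtain F :: "nat \<Rightarrow> 'a set" where F: "\<And>n. compact (F n)" "\<And>n. F n \<subseteq> ?K - N"
      "?K - N - (\<Union>n. F n) \<in> null_sets M" using inner_sigma_compact by blast
    define D where "D = ?K - (\<Union>n. F n)"
    have D_meas: "D \<in> sets M" unfolding D_def using cK F(1) by (intro sets.Diff sets.countable_UN) auto
    have D: "D \<in> null_sets M"
      by (rule null_sets_subset[OF null_sets.Un[OF F(3) N] D_meas]) (auto simp: D_def)
    have "uminus ` D = K - (\<Union>n. uminus ` F n)"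
      by (simp add: D_def image_set_diff inj_def image_UN uminus_uminus_image)
    then have "uminus ` D \<in> sets M"
      using K F(1) compact_uminus by (auto intro!: sets.Diff sets.countable_UN)
    then have "uminus ` D \<in> null_sets M"
    proof (rule null_sets_if_compact)
      fix C assume C: "compact C" "C \<subseteq> uminus ` D"
      then have "uminus ` C \<subseteq> D" by auto
      then have "uminus ` C \<in> null_sets M" using D by (rule complete2)
      then show "C \<in> null_sets M"
        using uminus_null_compact[of "uminus ` C"] compact_uminus[OF C(1)] uminus_uminus_image by simp
    qed
    moreover have "uminus ` N \<inter> K \<subseteq> uminus ` D" using F(2) by (force simp: D_def)
    ultimately show ?thesis using complete2 by blast
  qed
  then have "uminus ` N \<in> sets M" by (rule sets_if_compact)
  then show ?thesis
  proof (rule null_sets_if_compact)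
    fix C assume C: "compact C" "C \<subseteq> uminus ` N"
    then have "uminus ` C \<subseteq> N" by auto
    then have "uminus ` C \<in> null_sets M" using N by (rule complete2)
    then show "C \<in> null_sets M"
      using uminus_null_compact[of "uminus ` C"] compact_uminus[OF C(1)] uminus_uminus_image by simp
  qed
qed

text \<open>Inside a compact set, \<open>A\<close> is a countable union of compact sets up to a null
  set, and inversion respects both.\<close>

lemma uminus_sets:
  assumes A: "A \<in> sets M"
  shows "uminus ` A \<in> sets M"
proof (rule sets_if_compact)
  fix K :: "'a set" assume K: "compact K"
  let ?K = "uminus ` K"
  have cK: "compact ?K" using K by (rule compact_uminus)
  have "A \<inter> ?K \<in> sets M" using cK A by auto
  moreover have "emeasure M (A \<inter> ?K) < \<infinity>"
    using emeasure_mono[of "A \<inter> ?K" ?K M] cK emeasure_compact[OF cK] by (auto intro: le_less_trans)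
  ultimately obtain F :: "nat \<Rightarrow> 'a set" where F: "\<And>n. compact (F n)" "\<And>n. F n \<subseteq> A \<inter> ?K"
    "A \<inter> ?K - (\<Union>n. F n) \<in> null_sets M" using inner_sigma_compact by blast
  have "uminus ` A \<inter> K = uminus ` (A \<inter> ?K)" by (force simp: image_iff)
  also have "A \<inter> ?K = (\<Union>n. F n) \<union> (A \<inter> ?K - (\<Union>n. F n))" using F(2) by blast
  also have "uminus ` \<dots> = (\<Union>n. uminus ` F n) \<union> uminus ` (A \<inter> ?K - (\<Union>n. F n))" by blast
  also have "\<dots> \<in> sets M"
    using F(1) compact_uminus uminus_null[OF F(3)] by (intro sets.Un sets.countable_UN) auto
  finally show "uminus ` A \<inter> K \<in> sets M" .
qed

text \<open>Conjugation by inversion reduces measurability and nullity under right translations to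
  the left case.\<close>

lemma right_translate_eq: "(\<lambda>x. x + s) ` (A :: 'a set) = uminus ` (\<lambda>x. - s + x) ` uminus ` A"
  by (simp add: image_image minus_add)

lemma right_translate_sets: "A \<in> sets M \<Longrightarrow> (\<lambda>x. x + s) ` A \<in> sets M"
  unfolding right_translate_eq by (intro uminus_sets translate_sets)

lemma right_translate_null: "A \<in> null_sets M \<Longrightarrow> (\<lambda>x. x + s) ` A \<in> null_sets M"
  unfolding right_translate_eq by (intro uminus_null translate_null)

text \<open>Were all these intersections null, the Fubini argument would make the inverse of
  \<open>L\<close> null and, inverting once more, \<open>L\<close> itself.\<close>

lemma ex_translate_Int_nonnull:
  assumes "compact L" "compact F" "L \<notin> null_sets M" "F \<notin> null_sets M"
  shows "\<exists>s. (\<lambda>x. s + x) ` L \<inter> F \<notin> null_sets M"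
  using uminus_null_if_translates_null[OF assms(1,2,4)] uminus_null[of "uminus ` L"] assms(3)
  by (auto simp: uminus_uminus_image)

text \<open>Inversion exchanges the two sides: the left version for the inverses of \<open>L\<close>
  and \<open>F\<close> yields \<open>s\<close>, and \<open>- s\<close> serves on the right.\<close>

lemma ex_right_translate_Int_nonnull:
  assumes "compact L" "compact F" "L \<notin> null_sets M" "F \<notin> null_sets M"
  shows "\<exists>s. (\<lambda>x. x + s) ` L \<inter> F \<notin> null_sets M"
proof -
  have "uminus ` L \<notin> null_sets M" "uminus ` F \<notin> null_sets M"
    using uminus_null[of "uminus ` L"] uminus_null[of "uminus ` F"] assms(3,4)
    by (auto simp: uminus_uminus_image)
  then obtain s where s: "(\<lambda>x. s + x) ` uminus ` L \<inter> uminus ` F \<notin> null_sets M"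
    using ex_translate_Int_nonnull[of "uminus ` L" "uminus ` F"] compact_uminus assms by blast
  have "uminus ` ((\<lambda>x. x + - s) ` L \<inter> F) = (\<lambda>x. s + x) ` uminus ` L \<inter> uminus ` F"
  proof -
    have inj: "inj (uminus :: 'a \<Rightarrow> 'a)" by (simp add: inj_def)
    show ?thesis by (simp only: right_translate_eq image_Int[OF inj] minus_minus uminus_uminus_image)
  qed
  with s have "(\<lambda>x. x + - s) ` L \<inter> F \<notin> null_sets M"
    using uminus_null[of "(\<lambda>x. x + - s) ` L \<inter> F"] by auto
  then show ?thesis ..
qed

end

section \<open>Open representatives\<close>

text \<open>One framework for both translations; \<open>d y x\<close> recovers the element that
  moved \<open>x\<close> to \<open>y\<close>. The axioms speak of 0 and of inverses but not of sums,
  so right translations, which compose in reverse order, fit as well.\<close>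

locale haar_action = haar M for M :: "'a::{topological_group_add, t2_space} measure" +
  fixes f :: "'a \<Rightarrow> 'a \<Rightarrow> 'a" and d :: "'a \<Rightarrow> 'a \<Rightarrow> 'a"
  assumes act_0: "f 0 x = x"
    and act_minus: "f s (f (- s) x) = x"
    and diff_act: "d (f s x) x = s"
    and continuous_act: "continuous_on UNIV (\<lambda>(s, x). f s x)"
    and continuous_diff: "continuous_on UNIV (\<lambda>(y, x). d y x)"
    and act_sets: "A \<in> sets M \<Longrightarrow> f s ` A \<in> sets M"
    and act_null: "A \<in> null_sets M \<Longrightarrow> f s ` A \<in> null_sets M"
    and ex_act_Int_nonnull: "\<lbrakk>compact L; compact F; L \<notin> null_sets M; F \<notin> null_sets M\<rbrakk>
      \<Longrightarrow> \<exists>s. f s ` L \<inter> F \<notin> null_sets M"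
begin

lemma minus_act: "f (- s) (f s x) = x"
  using act_minus[of "- s"] by simp

lemma act_image_minus: "f s ` f (- s) ` A = A"
  by (simp add: image_image act_minus)

lemma inj_act: "inj (f s)"
  by (metis injI minus_act)

lemma act_image_Compl: "f s ` (- A) = - f s ` A"
  using act_minus by (intro bij_image_Compl_eq) (metis bijI inj_act surjI)

lemma act_image_neutral: "f 0 ` A = A"
  by (simp add: act_0)

text \<open>The tube lemma is applied to the open set \<open>W\<close> of pairs with
  \<open>f (- s) x \<in> U\<close>, that is, with \<open>x\<close> in the image of \<open>U\<close>
  under \<open>f s\<close>.\<close>

lemma compact_subset_act_image:
  assumes K: "compact K" and U: "open U" "K \<subseteq> U"
  obtains V where "V \<in> unit_nhds" "\<And>s. s \<in> V \<Longrightarrow> K \<subseteq> f s ` U"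
proof -
  define W where "W = (\<lambda>(s, x). f (- s) x) -` U"
  have "continuous_on UNIV (\<lambda>p. (\<lambda>(s, x). f s x) (- fst p, snd p))"
    by (rule continuous_on_compose2[OF continuous_act]) (auto intro!: continuous_intros)
  then have W: "open W"
    unfolding W_def using U(1) by (intro open_vimage) (simp_all add: case_prod_unfold)
  have "{0} \<times> K \<subseteq> W" using U(2) act_0 by (auto simp: W_def)
  from Elementary_Topology.tube_lemma[OF K W this]
  obtain V where V: "0 \<in> V" "open V" "V \<times> K \<subseteq> W"
    by blast
  show thesis
  proof
    show "V \<in> unit_nhds" using V by (simp add: unit_nhds_def)
    fix s assume "s \<in> V"
    show "K \<subseteq> f s ` U"
    proof
      fix x assume "x \<in> K"
      with V(3) \<open>s \<in> V\<close> have "f (- s) x \<in> U" by (auto simp: W_def)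
      then show "x \<in> f s ` U" using act_minus[of s x] by (metis imageI)
    qed
  qed
qed

text \<open>\<open>d\<close> is continuous and vanishes on the diagonal. The conclusion concerns
  \<open>- s\<close> because the hypothesis on \<open>C\<close> will be used at \<open>- s\<close>
  and then moved by \<open>s\<close>.\<close>

lemma small_neighbourhood:
  assumes V: "V \<in> unit_nhds"
  obtains N where "open N" "x \<in> N" "\<And>s y. y \<in> N \<Longrightarrow> f s y \<in> N \<Longrightarrow> - s \<in> V"
proof -
  define W where "W = (\<lambda>(y, z). - d y z) -` V"
  have dself: "d y y = 0" for y using diff_act[of 0 y] by (simp add: act_0)
  have "continuous_on UNIV (\<lambda>p. - (\<lambda>(y, z). d y z) p)"
    by (rule continuous_on_minus[OF continuous_diff])
  then have "open W"
    unfolding W_def using V by (intro open_vimage) (simp_all add: case_prod_unfold unit_nhds_def)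
  moreover have "(x, x) \<in> W" using V dself by (simp add: W_def unit_nhds_def)
  ultimately obtain A B where AB: "open A" "open B" "x \<in> A" "x \<in> B" "A \<times> B \<subseteq> W"
    by (rule open_prod_elim) auto
  show thesis
  proof
    show "open (A \<inter> B)" "x \<in> A \<inter> B" using AB by auto
    show "- s \<in> V" if "y \<in> A \<inter> B" "f s y \<in> A \<inter> B" for s y
      using that AB(5) diff_act[of s y] by (force simp: W_def)
  qed
qed

text \<open>The left-hand side is \<open>[A] \<le> \<Squnion>V. \<Sqinter>s\<in>V. [f s ` A]\<close>; the converse inequality is trivial.\<close>

lemma lower_condition_iff_open:
  assumes A: "A \<in> sets M"
  shows "(\<forall>B\<in>sets M. (\<forall>V\<in>unit_nhds. \<forall>C\<in>sets M.
       (\<forall>s\<in>V. C - f s ` A \<in> null_sets M) \<longrightarrow> C - B \<in> null_sets M) \<longrightarrow> A - B \<in> null_sets M)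
     \<longleftrightarrow> (\<exists>U. open U \<and> mclass M A = mclass M U)" (is "?lsc \<longleftrightarrow> ?open")
proof
  assume ?lsc
  define U where "U = \<Union>{N. open N \<and> N - A \<in> null_sets M}"
  have U: "open U" "U \<in> sets M" unfolding U_def by auto
  \<comment> \<open>The union defining \<open>U\<close> may be uncountable, but a compact subset is
    covered by finitely many of its members.\<close>
  have "U - A \<in> null_sets M"
  proof (rule null_sets_if_compact)
    fix K assume K: "compact K" "K \<subseteq> U - A"
    then have "K \<subseteq> \<Union>{N. open N \<and> N - A \<in> null_sets M}" unfolding U_def by blast
    then obtain T where T: "T \<subseteq> {N. open N \<and> N - A \<in> null_sets M}" "finite T" "K \<subseteq> \<Union>T"
      by (rule compactE[OF K(1)]) auto
    have "(\<Union>N\<in>T. N - A) \<in> null_sets M" using T by (intro null_sets.finite_UN) auto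
    moreover have "K \<subseteq> (\<Union>N\<in>T. N - A)" using T(3) K(2) by blast
    ultimately show "K \<in> null_sets M" by (rule complete2[rotated])
  qed (use U A in auto)
  moreover have "C - U \<in> null_sets M"
    if V: "V \<in> unit_nhds" and C: "C \<in> sets M" "\<And>s. s \<in> V \<Longrightarrow> C - f s ` A \<in> null_sets M" for V C
  proof (rule null_sets_if_compact)
    fix K assume K: "compact K" "K \<subseteq> C - U"
    show "K \<in> null_sets M"
    proof (rule ccontr)
      assume "K \<notin> null_sets M"
      then obtain x where x: "x \<in> K" "\<And>N. open N \<Longrightarrow> x \<in> N \<Longrightarrow> K \<inter> N \<notin> null_sets M"
        using nonnull_compact_point[OF K(1)] by blast
      obtain N where N: "open N" "x \<in> N" "\<And>s y. y \<in> N \<Longrightarrow> f s y \<in> N \<Longrightarrow> - s \<in> V"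
        using small_neighbourhood[OF V] by blast
      have "K \<inter> N \<notin> null_sets M" using x(2) N by blast
      moreover have "K \<inter> N \<in> sets M" using K N by auto
      ultimately obtain L where L: "compact L" "L \<subseteq> K \<inter> N" "L \<notin> null_sets M"
        using null_sets_if_compact by blast
      \<comment> \<open>Since \<open>x \<notin> U\<close>, the neighbourhood \<open>N\<close> is not
        among the open sets that make up \<open>U\<close>.\<close>
      have "N - A \<notin> null_sets M" using K(2) x(1) N unfolding U_def by blast
      moreover have "N - A \<in> sets M" using A N by auto
      ultimately obtain F where F: "compact F" "F \<subseteq> N - A" "F \<notin> null_sets M"
        using null_sets_if_compact by blast
      obtain s where s: "f s ` L \<inter> F \<notin> null_sets M"
        using ex_act_Int_nonnull[OF L(1) F(1) L(3) F(3)] by blast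
      then have "f s ` L \<inter> F \<noteq> {}" by auto
      then obtain y where "y \<in> L" "f s y \<in> F" by blast
      then have "- s \<in> V" using N(3) L(2) F(2) by blast
      \<comment> \<open>Acting by \<open>s\<close> on the hypothesis at \<open>- s\<close> moves
        \<open>C\<close> into \<open>A\<close> up to a null set, whereas the image of
        \<open>L \<subseteq> C\<close> meets \<open>F\<close>, which is disjoint from
        \<open>A\<close>, in a non-null set.\<close>
      then have "f s ` (C - f (- s) ` A) \<in> null_sets M" by (intro act_null C)
      moreover have "f s ` (C - f (- s) ` A) = f s ` C - A"
        by (simp add: image_set_diff inj_act act_image_minus)
      moreover have "f s ` L \<inter> F \<subseteq> f s ` C - A" using L(2) F(2) K(2) by blast
      ultimately show False using s complete2 by metis
    qed
  qed (use U C in auto)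
  then have "A - U \<in> null_sets M" using \<open>?lsc\<close> U(2) by blast
  ultimately have "sym_diff A U \<in> null_sets M" by (intro null_sets.Un)
  then have "mclass M A = mclass M U" using U A by (simp add: mclass_eq_iff)
  with U(1) show ?open by blast
next
  assume ?open
  then obtain U where U: "open U" "mclass M A = mclass M U" by blast
  have Us: "U \<in> sets M" using U by auto
  with U A have sd: "sym_diff A U \<in> null_sets M" by (simp add: mclass_eq_iff)
  have AU: "A - U \<in> null_sets M" and UA: "U - A \<in> null_sets M"
    by (auto intro: complete2[OF _ sd])
  show ?lsc
  proof (intro ballI impI)
    fix B assume B: "B \<in> sets M" and *: "\<forall>V\<in>unit_nhds. \<forall>C\<in>sets M.
       (\<forall>s\<in>V. C - f s ` A \<in> null_sets M) \<longrightarrow> C - B \<in> null_sets M"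
    \<comment> \<open>A compact \<open>K \<subseteq> U - B\<close> itself plays the role of
      \<open>C\<close>: for \<open>s\<close> near 0 it lies in the translates of \<open>U\<close>,
      hence essentially in those of \<open>A\<close>, so \<open>K - B = K\<close> is null.\<close>
    have "U - B \<in> null_sets M"
    proof (rule null_sets_if_compact)
      fix K assume K: "compact K" "K \<subseteq> U - B"
      obtain V where V: "V \<in> unit_nhds" "\<And>s. s \<in> V \<Longrightarrow> K \<subseteq> f s ` U"
        using compact_subset_act_image[OF K(1) U(1)] K(2) by blast
      have "K - f s ` A \<in> null_sets M" if "s \<in> V" for s
      proof -
        have "f s ` (U - A) \<in> null_sets M" using UA by (rule act_null)
        moreover have "K - f s ` A \<subseteq> f s ` (U - A)" using V(2)[OF that] by blast
        ultimately show ?thesis by (rule complete2[rotated])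
      qed
      then have "K - B \<in> null_sets M" using * V(1) compact_sets[OF K(1)] by blast
      moreover have "K - B = K" using K(2) by blast
      ultimately show "K \<in> null_sets M" by simp
    qed (use Us B in auto)
    then have "(A - U) \<union> (U - B) \<in> null_sets M" using AU by (intro null_sets.Un)
    then show "A - B \<in> null_sets M" by (rule complete2[rotated]) auto
  qed
qed

section \<open>Closed sets by complementation\<close>

lemma Compl_sets: "A \<in> sets M \<Longrightarrow> - A \<in> sets M"
  using sets.compl_sets[of A M] by (simp add: space_eq_UNIV Compl_eq_Diff_UNIV)

text \<open>Complementation reverses inclusion up to null sets and commutes with the bijections
  \<open>f s\<close>, so it suffices to replace the quantified sets \<open>B\<close> and
  \<open>C\<close> by their complements.\<close>

lemma upper_condition_iff_lower_condition_Compl: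
  assumes A: "A \<in> sets M"
  shows "(\<forall>B\<in>sets M. (\<forall>V\<in>unit_nhds. \<forall>C\<in>sets M.
       (\<forall>s\<in>V. f s ` A - C \<in> null_sets M) \<longrightarrow> B - C \<in> null_sets M) \<longrightarrow> B - A \<in> null_sets M)
     \<longleftrightarrow> (\<forall>B\<in>sets M. (\<forall>V\<in>unit_nhds. \<forall>C\<in>sets M.
       (\<forall>s\<in>V. C - f s ` (- A) \<in> null_sets M) \<longrightarrow> C - B \<in> null_sets M) \<longrightarrow> - A - B \<in> null_sets M)"
    (is "?upper \<longleftrightarrow> ?lower")
proof -
  have all_Compl: "(\<forall>B\<in>sets M. P B) \<longleftrightarrow> (\<forall>B\<in>sets M. P (- B))" for P
    using Compl_sets by (metis double_complement)
  have "?upper \<longleftrightarrow> (\<forall>B\<in>sets M. (\<forall>V\<in>unit_nhds. \<forall>C\<in>sets M.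
       (\<forall>s\<in>V. f s ` A - - C \<in> null_sets M) \<longrightarrow> - B - - C \<in> null_sets M) \<longrightarrow> - B - A \<in> null_sets M)"
    by (rule trans[OF all_Compl], rule ball_cong[OF refl], rule imp_cong[OF _ refl],
        rule ball_cong[OF refl], rule all_Compl)
  also have "\<dots> \<longleftrightarrow> ?lower"
    by (simp add: act_image_Compl Diff_eq Int_commute)
  finally show ?thesis .
qed

lemma open_Compl_iff_closed:
  assumes A: "A \<in> sets M"
  shows "(\<exists>U. open U \<and> mclass M (- A) = mclass M U) \<longleftrightarrow> (\<exists>C. closed C \<and> mclass M A = mclass M C)"
proof -
  have Compl: "- A \<in> sets M" using A by (rule Compl_sets)
  have "mclass M (- A) = mclass M U \<longleftrightarrow> mclass M A = mclass M (- U)" if "open U" for U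
  proof -
    have "sym_diff (- A) U = sym_diff A (- U)" by blast
    moreover have "- U \<in> sets M" "U \<in> sets M" using that by auto
    ultimately show ?thesis using A Compl by (simp add: mclass_eq_iff)
  qed
  then show ?thesis by (metis closed_def double_complement)
qed

text \<open>\<open>act\<close> is tied to \<open>f\<close> only through the class of
  \<open>A\<close>, so \<open>left_act\<close> and \<open>right_act\<close> can be inserted once
  their values on classes are known.\<close>

theorem semicontinuous_iff:
  assumes A: "A \<in> sets M" and act: "\<And>s. act s (mclass M A) = mclass M (f s ` A)"
  shows "lower_semicontinuous_at (measure_algebra M) act (mclass M A) \<longleftrightarrow>
      (\<exists>U. open U \<and> mclass M A = mclass M U)"
    and "upper_semicontinuous_at (measure_algebra M) act (mclass M A) \<longleftrightarrow>
      (\<exists>C. closed C \<and> mclass M A = mclass M C)"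
proof -
  have Compl: "- A \<in> sets M" using A by (rule Compl_sets)
  show "lower_semicontinuous_at (measure_algebra M) act (mclass M A) \<longleftrightarrow>
      (\<exists>U. open U \<and> mclass M A = mclass M U)"
    unfolding lower_condition_iff_open[OF A, symmetric]
    by (intro lower_semicontinuous_at_mclass_iff localizable A act_sets act_image_neutral act)
  show "upper_semicontinuous_at (measure_algebra M) act (mclass M A) \<longleftrightarrow>
      (\<exists>C. closed C \<and> mclass M A = mclass M C)"
    unfolding open_Compl_iff_closed[OF A, symmetric] lower_condition_iff_open[OF Compl, symmetric]
      upper_condition_iff_lower_condition_Compl[OF A, symmetric]
    by (intro upper_semicontinuous_at_mclass_iff localizable A act_sets act_image_neutral act)
qed

end

section \<open>Left and right translations as instances\<close>

context haar
begin

text \<open>Independence of the representative rests on right translations preserving null sets,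
  hence on inversion doing so.\<close>

lemma right_act_mclass:
  assumes A: "A \<in> sets M"
  shows "right_act M s (mclass M A) = mclass M ((\<lambda>x. x + s) ` A)"
proof -
  have "mclass M ((\<lambda>x. x + s) ` B) = mclass M ((\<lambda>x. x + s) ` A)" if "B \<in> mclass M A" for B
  proof -
    have B: "B \<in> sets M" "sym_diff B A \<in> null_sets M"
      using that by (auto simp: mclass_def null_rel_def Un_commute)
    have "sym_diff ((\<lambda>x. x + s) ` B) ((\<lambda>x. x + s) ` A) = (\<lambda>x. x + s) ` sym_diff B A"
      by (auto simp: image_iff)
    also have "\<dots> \<in> null_sets M" using B(2) by (rule right_translate_null)
    finally show ?thesis using right_translate_sets A B(1) by (simp add: mclass_eq_iff)
  qed
  moreover have "A \<in> mclass M A" using A by (auto simp: mclass_def null_rel_def)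
  ultimately show ?thesis unfolding right_act_def by blast
qed

lemma continuous_diff_prod: "continuous_on UNIV (\<lambda>(y, x). y - x :: 'a)"
  "continuous_on UNIV (\<lambda>(y, x). - x + y :: 'a)"
  by (auto simp: case_prod_unfold diff_conv_add_uminus simp del: add_uminus_conv_diff
      intro!: continuous_intros)

lemma haar_action_left: "haar_action M (\<lambda>s x. s + x) (\<lambda>y x. y - x)"
  using ex_translate_Int_nonnull continuous_diff_prod(1)
  by unfold_locales
    (auto simp: translate_sets translate_null case_prod_unfold add.assoc[symmetric]
      intro!: continuous_intros)

lemma haar_action_right: "haar_action M (\<lambda>s x. x + s) (\<lambda>y x. - x + y)"
  using ex_right_translate_Int_nonnull continuous_diff_prod(2)
  by unfold_locales
    (auto simp: right_translate_sets right_translate_null case_prod_unfold add.assoc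
      intro!: continuous_intros)

end

theorem proposition4p6:
  fixes M :: "'a::{topological_group_add, t2_space} measure" and a :: "'a set set"
  assumes "locally_compact_space (euclidean :: 'a topology)"
    and "left_haar_measure M"
    and "a \<in> carrier (measure_algebra M)"
  shows "((\<exists>U. open U \<and> a = mclass M U) \<longleftrightarrow>
            lower_semicontinuous_at (measure_algebra M) (left_act M) a) \<and>
         ((\<exists>U. open U \<and> a = mclass M U) \<longleftrightarrow>
            lower_semicontinuous_at (measure_algebra M) (right_act M) a) \<and>
         ((\<exists>C. closed C \<and> a = mclass M C) \<longleftrightarrow>
            upper_semicontinuous_at (measure_algebra M) (left_act M) a) \<and>
         ((\<exists>C. closed C \<and> a = mclass M C) \<longleftrightarrow>
            upper_semicontinuous_at (measure_algebra M) (right_act M) a)"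
proof -
  interpret haar M using assms(1,2) by unfold_locales
  interpret left: haar_action M "\<lambda>s x. s + x" "\<lambda>y x. y - x" by (rule haar_action_left)
  interpret right: haar_action M "\<lambda>s x. x + s" "\<lambda>y x. - x + y" by (rule haar_action_right)
  obtain A where A: "A \<in> sets M" "a = mclass M A"
    using assms(3) by (auto simp: carrier_measure_algebra)
  show ?thesis
    unfolding A(2) left.semicontinuous_iff[of A "left_act M", OF A(1) left_act_mclass[OF assms(2) A(1)]]
      right.semicontinuous_iff[of A "right_act M", OF A(1) right_act_mclass[OF A(1)]]
    by simp
qed

end
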